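(* Let $S$ be a finite set and let $f,g:S\to S$ be commuting functions, $fg=gf$. Let $\mathbf{Z}_i=\{Z_{i,1},\dots,Z_{i,n_i}\}$ be the set of directed cycles of length $i$ of $\Gamma(f)$, and let $\mathbf{Z}=\bigsqcup_i\mathbf{Z}_i$. Then the restriction of $g$ to the set $\mathcal{V}(\mathbf{Z})$ of vertices lying on these cycles determines a function $\widetilde g:\mathbf{Z}\to\mathbf{Z}$ (where $\widetilde g(Z)$ is the cycle of $\Gamma(f)$ with vertex set $g(\mathcal{V}(Z))$) such that the length of $\widetilde g(Z_{i,j})$ divides $i$ for all $i,j$.
   Context: The functional graph $\Gamma(f)$ has vertex set $S$ and edges $[s,f(s)]$, $s\in S$. $\mathcal{V}(Z)$ is the vertex set of a cycle $Z$; loops are cycles of length $1$. *)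

theory Defs
  imports "Graph_Theory.Graph_Theory" "HOL-Library.FuncSet"
begin

definition functional_graph :: "'a set \<Rightarrow> ('a \<Rightarrow> 'a) \<Rightarrow> ('a, 'a \<times> 'a) pre_digraph" where
  "functional_graph S f = \<lparr>verts = S, arcs = {(s, f s) | s. s \<in> S}, tail = fst, head = snd\<rparr>"

lemma fin_digraph_functional_graph:
  assumes "finite S" "f \<in> S \<rightarrow> S"
  shows "fin_digraph (functional_graph S f)"
  using assms by unfold_locales (auto simp: functional_graph_def)

text \<open>The library predicate \<^const>\<open>pre_digraph.cycle\<close> describes a cycle as a closed walk, so that a
  cycle with \<open>n\<close> vertices is represented by \<open>n\<close> different walks, one for each starting point.
  A directed cycle is here the subgraph traced by such a walk, which does not depend on the
  starting point. Loops are cycles in this sense.\<close>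

definition walk_subgraph :: "('a, 'b) pre_digraph \<Rightarrow> 'b awalk \<Rightarrow> ('a, 'b) pre_digraph" where
  "walk_subgraph G p =
    \<lparr>verts = tail G ` set p \<union> head G ` set p, arcs = set p, tail = tail G, head = head G\<rparr>"

definition directed_cycles :: "('a, 'b) pre_digraph \<Rightarrow> ('a, 'b) pre_digraph set" where
  "directed_cycles G = {walk_subgraph G p | p. pre_digraph.cycle G p}"

definition cycle_length :: "('a, 'b) pre_digraph \<Rightarrow> nat" where
  "cycle_length Z = card (arcs Z)"

lemma (in wf_digraph) cycle_length_walk_subgraph:
  assumes "cycle p"
  shows "cycle_length (walk_subgraph G p) = length p"
  using assms by (auto simp: cycle_conv cycle_length_def walk_subgraph_def distinct_card)

definition directed_cycles_of_length :: "('a, 'b) pre_digraph \<Rightarrow> nat \<Rightarrow> ('a, 'b) pre_digraph set" where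
  "directed_cycles_of_length G i = {Z \<in> directed_cycles G. cycle_length Z = i}"

definition cycle_verts :: "('a, 'b) pre_digraph \<Rightarrow> 'a set" where
  "cycle_verts G = (\<Union>Z\<in>directed_cycles G. verts Z)"

text \<open>The map \<open>Z \<mapsto> g~(Z)\<close>. It is meaningful only where the described cycle exists and is unique.\<close>

definition induced_cycle_map ::
  "('a, 'b) pre_digraph \<Rightarrow> ('a \<Rightarrow> 'a) \<Rightarrow> ('a, 'b) pre_digraph \<Rightarrow> ('a, 'b) pre_digraph" where
  "induced_cycle_map G g Z = (THE W. W \<in> directed_cycles G \<and> verts W = g ` verts Z)"

end

theory Submission
  imports Defs "HOL-Combinatorics.Cycles"
begin

text \<open>A directed cycle of the functional graph of \<open>f\<close> is nothing but an orbit of \<open>f\<close> that \<open>f\<close>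
  permutes cyclically: out of every vertex there is only one arc, so a walk is determined by its
  starting point and its length, and a cycle is determined by its vertex set
  (\<open>directed_cycles_functional_graph\<close>). The function \<open>g\<close> commutes with \<open>f\<close>, so it sends the
  orbit of \<open>x\<close> onto the orbit of \<open>g x\<close>; this is the map on cycles, and since vertex sets determine
  cycles, there is no choice in it.

  The length of the cycle through \<open>x\<close> is the least period of \<open>x\<close> under \<open>f\<close>
  (\<open>card_orbit_eq_least_power\<close>). If \<open>f\<^sup>i x = x\<close>, then \<open>f\<^sup>i (g x) = g (f\<^sup>i x) = g x\<close>, so \<open>i\<close> is
  a period of \<open>g x\<close> and hence a multiple of its least period (\<open>card_image_cyclic_dvd\<close>).\<close>

text \<open>Before the first return to \<open>x\<close> all iterates are distinct, since two equal ones would lead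
  back to \<open>x\<close> earlier; after it they repeat.\<close>

lemma card_orbit_eq_least_power:
  assumes "x \<in> orbit f x"
  shows "card (orbit f x) = least_power f x"
proof -
  have "card (orbit f x) = funpow_dist1 f x x"
    by (subst orbit_conv_funpow_dist1[OF assms])
       (simp add: card_image[OF inj_on_funpow_dist1[OF assms]])
  also have "\<dots> = least_power f x"
  proof (rule antisym)
    have "(f ^^ least_power f x) x = x" "least_power f x > 0"
      using least_powerI[OF funpow_dist1_prop[OF assms]] by simp_all
    then show "funpow_dist1 f x x \<le> least_power f x"
      using assms by (rule funpow_dist1_le_self)
    show "least_power f x \<le> funpow_dist1 f x x"
      by (rule least_power_le[OF funpow_dist1_prop[OF assms]]) simp
  qed
  finally show ?thesis .
qed

text \<open>Both cardinalities are least periods, of some \<open>x \<in> C\<close> and of \<open>g x\<close>, and every period of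
  \<open>x\<close> is one of \<open>g x\<close>.\<close>

lemma card_image_cyclic_dvd:
  assumes "cyclic_on f C" and commute: "\<And>x. x \<in> C \<Longrightarrow> f (g x) = g (f x)"
  shows "card (g ` C) dvd card C"
proof -
  obtain x where x: "x \<in> C" "C = orbit f x"
    using assms(1) by (auto simp: cyclic_on_def)
  have gC: "g ` C = orbit f (g x)"
    by (rule orbit_cyclic_eq3[symmetric])
       (use cyclic_on_image[where g = f and h = g, OF assms] x(1) in auto)
  have "(f ^^ n) (g x) = g ((f ^^ n) x)" for n
    by (induction n) (simp_all add: commute cyclic_on_funpow_in[OF assms(1) x(1)])
  moreover have "(f ^^ card C) x = x"
  proof -
    have self: "x \<in> orbit f x"
      using x by simp
    show ?thesis
      unfolding x(2) card_orbit_eq_least_power[OF self]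
      by (rule least_powerI(1)[OF funpow_dist1_prop[OF self]]) simp
  qed
  ultimately have "(f ^^ card C) (g x) = g x"
    by simp
  then have "least_power f (g x) dvd card C"
    by (rule least_power_minimal)
  moreover have "g x \<in> orbit f (g x)"
    using x(1) unfolding gC[symmetric] by blast
  ultimately show ?thesis
    unfolding gC by (simp add: card_orbit_eq_least_power)
qed

primrec orbit_walk :: "('a \<Rightarrow> 'a) \<Rightarrow> 'a \<Rightarrow> nat \<Rightarrow> ('a \<times> 'a) list" where
  "orbit_walk f u 0 = []"
| "orbit_walk f u (Suc n) = (u, f u) # orbit_walk f (f u) n"

lemma length_orbit_walk [simp]: "length (orbit_walk f u n) = n"
  by (induction n arbitrary: u) simp_all

lemma set_orbit_walk: "set (orbit_walk f u n) = {((f ^^ i) u, f ((f ^^ i) u)) | i. i < n}"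
proof (induction n arbitrary: u)
  case (Suc n)
  have "{((f ^^ i) u, f ((f ^^ i) u)) | i. i < Suc n} = (\<lambda>i. ((f ^^ i) u, f ((f ^^ i) u))) ` {..<Suc n}"
    by blast
  also have "\<dots> = insert (u, f u) {((f ^^ i) (f u), f ((f ^^ i) (f u))) | i. i < n}"
    unfolding lessThan_Suc_eq_insert_0 by (auto simp: image_iff funpow_swap1)
  finally show ?case
    using Suc by simp
qed simp

lemma awalk_functional_graph_iff:
  assumes "f \<in> S \<rightarrow> S"
  shows "pre_digraph.awalk (functional_graph S f) u p v \<longleftrightarrow>
    u \<in> S \<and> p = orbit_walk f u (length p) \<and> v = (f ^^ length p) u"
proof (induction p arbitrary: u)
  case Nil
  then show ?case
    by (auto simp: pre_digraph.awalk_def pre_digraph.cas.simps functional_graph_def)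
next
  case (Cons e p)
  have "pre_digraph.awalk (functional_graph S f) u (e # p) v \<longleftrightarrow>
      u \<in> S \<and> e = (u, f u) \<and> pre_digraph.awalk (functional_graph S f) (f u) p v"
    using assms by (auto simp: pre_digraph.awalk_def pre_digraph.cas.simps functional_graph_def)
  then show ?case
    using assms by (auto simp: Cons.IH funpow_swap1)
qed

lemma awalk_verts_orbit_walk:
  "pre_digraph.awalk_verts (functional_graph S f) u (orbit_walk f u n)
    = map (\<lambda>i. (f ^^ i) u) [0..<Suc n]"
proof (induction n arbitrary: u)
  case (Suc n)
  have "map (\<lambda>i. (f ^^ i) u) [0..<Suc (Suc n)] = u # map (\<lambda>i. (f ^^ i) (f u)) [0..<Suc n]"
    by (subst upt_conv_Cons) (simp_all add: map_Suc_upt[symmetric] funpow_swap1 del: upt_Suc)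
  then show ?case
    using Suc by (simp add: pre_digraph.awalk_verts.simps functional_graph_def del: upt_Suc)
qed (simp add: pre_digraph.awalk_verts.simps)

text \<open>Here \<open>n\<close> can be any positive period of \<open>u\<close>: going round several times repeats the same
  arcs, and a subgraph has only their set.\<close>

lemma walk_subgraph_orbit_walk:
  assumes "(f ^^ n) u = u" "0 < n"
  shows "walk_subgraph (functional_graph S f) (orbit_walk f u n) = functional_graph (orbit f u) f"
proof -
  have arcs: "set (orbit_walk f u n) = (\<lambda>s. (s, f s)) ` orbit f u"
    unfolding set_orbit_walk orbit_altdef_bounded[OF assms] by blast
  have "f ` orbit f u \<subseteq> orbit f u"
    by (auto intro: orbit.step)
  then show ?thesis
    unfolding walk_subgraph_def arcs
    by (auto simp: functional_graph_def image_image)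
qed

text \<open>Since arcs are forced, a closed walk from \<open>u\<close> traces the whole orbit of \<open>u\<close>. Conversely, the
  walk from \<open>u\<close> whose length is the least period of \<open>u\<close> is closed, and its vertices are distinct by
  counting: it lists as many of them as the orbit has elements, and it reaches them all.\<close>

lemma directed_cycles_functional_graph:
  assumes "f \<in> S \<rightarrow> S"
  shows "directed_cycles (functional_graph S f)
    = (\<lambda>C. functional_graph C f) ` {C. C \<subseteq> S \<and> cyclic_on f C}" (is "?L = ?R")
proof (intro subset_antisym subsetI)
  fix Z assume "Z \<in> ?L"
  then obtain u p where p: "pre_digraph.awalk (functional_graph S f) u p u" "p \<noteq> []"
    and Z: "Z = walk_subgraph (functional_graph S f) p"
    by (auto simp: directed_cycles_def pre_digraph.cycle_def)
  define n where "n = length p"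
  have u: "u \<in> S" "p = orbit_walk f u n" "(f ^^ n) u = u" "0 < n"
    using p by (simp_all add: awalk_functional_graph_iff[OF assms] n_def)
  then have "Z = functional_graph (orbit f u) f"
    using Z by (simp add: walk_subgraph_orbit_walk)
  moreover have "orbit f u \<subseteq> S"
  proof
    fix y assume "y \<in> orbit f u"
    then show "y \<in> S" by induction (use u(1) assms in auto)
  qed
  moreover have "u \<in> orbit f u"
    using u(3,4) by (auto simp: orbit_altdef intro!: exI[of _ n])
  then have "cyclic_on f (orbit f u)"
    by (rule cyclic_on_singleI) simp
  ultimately show "Z \<in> ?R"
    by blast
next
  fix Z assume "Z \<in> ?R"
  then obtain u where u: "u \<in> S" "u \<in> orbit f u" and Z: "Z = functional_graph (orbit f u) f"
    by (auto simp: cyclic_on_def)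
  define n where "n = least_power f u"
  have n: "(f ^^ n) u = u" "0 < n"
    unfolding n_def using least_powerI[OF funpow_dist1_prop[OF u(2)]] by simp_all
  let ?vs = "map (\<lambda>i. (f ^^ i) u) [1..<Suc n]"
  have tl_verts: "tl (pre_digraph.awalk_verts (functional_graph S f) u (orbit_walk f u n)) = ?vs"
    unfolding awalk_verts_orbit_walk by (subst upt_conv_Cons) simp_all
  have "orbit f u \<subseteq> set ?vs"
  proof
    fix y assume "y \<in> orbit f u"
    then obtain i where i: "y = (f ^^ i) u" "i < n"
      by (auto simp: orbit_altdef_bounded[OF n])
    \<comment> \<open>The starting point is listed under the index \<open>n\<close> instead of \<open>0\<close>.\<close>
    then have "y = (f ^^ (if i = 0 then n else i)) u" "(if i = 0 then n else i) \<in> set [1..<Suc n]"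
      using n by auto
    then show "y \<in> set ?vs"
      unfolding set_map by (rule image_eqI)
  qed
  moreover have "set ?vs \<subseteq> orbit f u"
    by (auto simp: orbit_altdef)
  ultimately have "set ?vs = orbit f u"
    by (rule subset_antisym[rotated])
  then have "distinct ?vs"
    by (intro card_distinct) (simp add: card_orbit_eq_least_power[OF u(2)] n_def del: upt_Suc)
  moreover have "pre_digraph.awalk (functional_graph S f) u (orbit_walk f u n) u"
    using u(1) n by (simp add: awalk_functional_graph_iff[OF assms])
  moreover have "orbit_walk f u n \<noteq> []"
    using n(2) by (cases n) simp_all
  ultimately have "pre_digraph.cycle (functional_graph S f) (orbit_walk f u n)"
    unfolding pre_digraph.cycle_def using tl_verts by auto
  then show "Z \<in> ?L"
    unfolding directed_cycles_def Z using walk_subgraph_orbit_walk[OF n, of S] by force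
qed

lemma cycle_length_functional_graph: "cycle_length (functional_graph C f) = card C"
proof -
  have "arcs (functional_graph C f) = (\<lambda>s. (s, f s)) ` C"
    by (auto simp: functional_graph_def)
  then show ?thesis
    by (simp add: cycle_length_def card_image inj_on_def)
qed

lemma verts_functional_graph [simp]: "verts (functional_graph C f) = C"
  by (simp add: functional_graph_def)

theorem theorem2p23:
  fixes S :: "'a set" and f g :: "'a \<Rightarrow> 'a"
  assumes "finite S"
    and "f \<in> S \<rightarrow> S" and "g \<in> S \<rightarrow> S"
    and "\<forall>s\<in>S. f (g s) = g (f s)"
  defines "\<Gamma> \<equiv> functional_graph S f"
  shows "g \<in> cycle_verts \<Gamma> \<rightarrow> cycle_verts \<Gamma>
    \<and> (\<forall>Z\<in>directed_cycles \<Gamma>. \<exists>!W. W \<in> directed_cycles \<Gamma> \<and> verts W = g ` verts Z)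
    \<and> induced_cycle_map \<Gamma> g \<in> directed_cycles \<Gamma> \<rightarrow> directed_cycles \<Gamma>
    \<and> (\<forall>Z\<in>directed_cycles \<Gamma>. verts (induced_cycle_map \<Gamma> g Z) = g ` verts Z)
    \<and> (\<forall>i. \<forall>Z\<in>directed_cycles_of_length \<Gamma> i. cycle_length (induced_cycle_map \<Gamma> g Z) dvd i)"
proof -
  have cycles: "Z \<in> directed_cycles \<Gamma> \<longleftrightarrow> (\<exists>C\<subseteq>S. cyclic_on f C \<and> Z = functional_graph C f)" for Z
    unfolding \<Gamma>_def directed_cycles_functional_graph[OF assms(2)] by blast
  have image: "g ` C \<subseteq> S" "cyclic_on f (g ` C)" "card (g ` C) dvd card C"
    if "C \<subseteq> S" "cyclic_on f C" for C
  proof -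
    have commute: "f (g x) = g (f x)" if "x \<in> C" for x
      using that \<open>C \<subseteq> S\<close> assms(4) by blast
    show "g ` C \<subseteq> S"
      using \<open>C \<subseteq> S\<close> assms(3) by blast
    show "cyclic_on f (g ` C)"
      using \<open>cyclic_on f C\<close> commute by (rule cyclic_on_image)
    show "card (g ` C) dvd card C"
      using \<open>cyclic_on f C\<close> commute by (rule card_image_cyclic_dvd)
  qed
  have unique: "W \<in> directed_cycles \<Gamma> \<and> verts W = g ` C \<longleftrightarrow> W = functional_graph (g ` C) f"
    if "C \<subseteq> S" "cyclic_on f C" for C W
    using image(1,2)[OF that] by (auto simp: cycles)
  have map: "induced_cycle_map \<Gamma> g (functional_graph C f) = functional_graph (g ` C) f"
    if "C \<subseteq> S" "cyclic_on f C" for C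
    unfolding induced_cycle_map_def by (simp add: unique[OF that])
  show ?thesis
  proof (intro conjI)
    show "g \<in> cycle_verts \<Gamma> \<rightarrow> cycle_verts \<Gamma>"
    proof
      fix x assume "x \<in> cycle_verts \<Gamma>"
      then obtain C where C: "C \<subseteq> S" "cyclic_on f C" "x \<in> C"
        by (auto simp: cycle_verts_def cycles)
      then have "functional_graph (g ` C) f \<in> directed_cycles \<Gamma>"
        using image(1,2)[OF C(1,2)] unfolding cycles by blast
      then show "g x \<in> cycle_verts \<Gamma>"
        using C(3) by (force simp: cycle_verts_def)
    qed
    show "\<forall>Z\<in>directed_cycles \<Gamma>. \<exists>!W. W \<in> directed_cycles \<Gamma> \<and> verts W = g ` verts Z"
    proof
      fix Z assume "Z \<in> directed_cycles \<Gamma>"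
      then obtain C where C: "C \<subseteq> S" "cyclic_on f C" "Z = functional_graph C f"
        by (auto simp: cycles)
      show "\<exists>!W. W \<in> directed_cycles \<Gamma> \<and> verts W = g ` verts Z"
        unfolding C(3) verts_functional_graph unique[OF C(1,2)] by blast
    qed
    show "induced_cycle_map \<Gamma> g \<in> directed_cycles \<Gamma> \<rightarrow> directed_cycles \<Gamma>"
    proof
      fix Z assume "Z \<in> directed_cycles \<Gamma>"
      then obtain C where C: "C \<subseteq> S" "cyclic_on f C" "Z = functional_graph C f"
        by (auto simp: cycles)
      show "induced_cycle_map \<Gamma> g Z \<in> directed_cycles \<Gamma>"
        unfolding C(3) map[OF C(1,2)] cycles using image(1,2)[OF C(1,2)] by blast
    qed
    show "\<forall>Z\<in>directed_cycles \<Gamma>. verts (induced_cycle_map \<Gamma> g Z) = g ` verts Z"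
      using map by (auto simp: cycles)
    show "\<forall>i. \<forall>Z\<in>directed_cycles_of_length \<Gamma> i. cycle_length (induced_cycle_map \<Gamma> g Z) dvd i"
      using image(3) map
      by (auto simp: directed_cycles_of_length_def cycles cycle_length_functional_graph)
  qed
qed

end
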